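(* Let $n=p_1p_2\cdots p_m$ where $m\ge 2$ and $p_1<p_2<\dots<p_m$ are primes. Let $G_2$ be the induced subgraph of the comaximal graph $\Gamma(\mathbb{Z}_n)$ on the set of nonzero non-units of $\mathbb{Z}_n$. Then the vertex connectivity of $G_2$ satisfies $\kappa(G_2)\le\phi(p_1p_2\cdots p_{m-1})$.
   Context: The comaximal graph $\Gamma(\mathbb{Z}_n)$ has vertex set $\mathbb{Z}_n=\{0,1,\dots,n-1\}$, distinct $x,y$ adjacent iff $\langle x\rangle+\langle y\rangle=\mathbb{Z}_n$. The non-units are the $a$ with $\gcd(a,n)\neq 1$. A separating set of a connected graph $G$ is a set $S\subset V(G)$ such that $G-S$ has more than one connected component; $\kappa(G)$ is the minimum size of a separating set. $\phi$ is Euler's totient function. *)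

theory Defs
  imports
    "HOL-Number_Theory.Number_Theory"
    "HOL-Algebra.Ideal"
    "HOL-Library.Extended_Nat"
    "Graph_Theory.Graph_Theory"
begin

text \<open>
  Following \<^theory>\<open>Graph_Theory.Digraph\<close>, an undirected simple graph is a finite loop-free
  symmetric digraph without parallel arcs.
\<close>

definition comaximal_graph :: "('a, 'm) ring_scheme \<Rightarrow> ('a, 'a \<times> 'a) pre_digraph" where
  "comaximal_graph R = with_proj
     \<lparr> pverts = carrier R,
       parcs = {(x, y). x \<in> carrier R \<and> y \<in> carrier R \<and> x \<noteq> y \<and>
                        Idl\<^bsub>R\<^esub> {x} <+>\<^bsub>R\<^esub> Idl\<^bsub>R\<^esub> {y} = carrier R} \<rparr>"

definition nonunits_mod :: "nat \<Rightarrow> int set" where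
  "nonunits_mod n = {a \<in> carrier (residue_ring (int n)). gcd a (int n) \<noteq> 1}"

definition comaximal_G2 :: "nat \<Rightarrow> (int, int \<times> int) pre_digraph" where
  "comaximal_G2 n = comaximal_graph (residue_ring (int n)) \<restriction> (nonunits_mod n - {0})"

text \<open>
  The strongly connected components of a symmetric digraph are the connected components of the
  undirected graph it represents.
\<close>

definition separating_set :: "('a, 'b) pre_digraph \<Rightarrow> 'a set \<Rightarrow> bool" where
  "separating_set G S \<longleftrightarrow> S \<subseteq> verts G \<and>
     (\<exists>C\<in>pre_digraph.sccs (G \<restriction> (verts G - S)).
      \<exists>D\<in>pre_digraph.sccs (G \<restriction> (verts G - S)). C \<noteq> D)"

text \<open>
  The infimum is taken in \<^typ>\<open>enat\<close>, so that a graph without separating set (a complete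
  graph) has connectivity \<open>\<infinity>\<close>; on \<^typ>\<open>nat\<close> the infimum of the empty set
  would be \<open>0\<close>, and an upper bound could hold vacuously. A disconnected graph is separated
  by the empty set.
\<close>

definition vertex_connectivity :: "('a, 'b) pre_digraph \<Rightarrow> enat" where
  "vertex_connectivity G = (INF S \<in> {S. finite S \<and> separating_set G S}. enat (card S))"

end

theory Submission
  imports Defs
begin

text \<open>
  Put $M = p_1 \cdots p_{m-1}$ and $q = p_m$. A neighbour of the vertex $M$ in $G_2$ is coprime
  to $M$ but not to $Mq$, hence has the form $qz$ with $0 < z < M$ and $\gcd(z,M)=1$; there are
  at most $\phi(M)$ of these. Deleting them isolates $M$, and since $q > 2$ the vertex $2M$ survives.
\<close>

text \<open>Once \<open>S\<close> is deleted, no arc leaves \<open>u\<close>, so \<open>u\<close>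
  reaches only itself and its strong component cannot contain \<open>v\<close>. Tracking the
  successors of \<open>u\<close> is enough, because strong components require reachability in both
  directions.\<close>

lemma separating_set_neighbours:
  assumes "wf_digraph G" "u \<in> verts G - S" "v \<in> verts G - S" "u \<noteq> v" "S \<subseteq> verts G"
    and nbrs: "\<And>y. u \<rightarrow>\<^bsub>G\<^esub> y \<Longrightarrow> y \<in> S"
  shows "separating_set G S"
proof -
  interpret G: wf_digraph G by fact
  define H where "H = G \<restriction> (verts G - S)"
  interpret H: wf_digraph H
    unfolding H_def by (rule G.wellformed_induce_subgraph)
  have vertsH: "verts H = verts G - S" by (simp add: H_def)
  have no_succ: "\<not> u \<rightarrow>\<^bsub>H\<^esub> y" for y
  proof
    assume "u \<rightarrow>\<^bsub>H\<^esub> y"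
    then have "u \<rightarrow>\<^bsub>G\<^esub> y" "y \<in> verts H"
      by (auto simp: H_def arcs_ends_conv)
    with nbrs vertsH show False by auto
  qed
  have "\<not> u \<rightarrow>\<^sup>*\<^bsub>H\<^esub> v"
    \<comment> \<open>A walk from \<open>u\<close> to \<open>v \<noteq> u\<close> would have to
      begin with an arc out of \<open>u\<close>.\<close>
    using no_succ \<open>u \<noteq> v\<close> by (meson H.converse_reachable_cases)
  then have "v \<notin> H.scc_of u" by (auto simp: H.scc_of_def)
  moreover have "v \<in> H.scc_of v" using assms vertsH by (intro H.in_scc_of_self) auto
  moreover have "H \<restriction> H.scc_of u \<in> H.sccs" "H \<restriction> H.scc_of v \<in> H.sccs"
    using assms vertsH by (auto intro!: H.in_verts_sccsD_sccs H.scc_of_in_sccs_verts simp flip: H.sccs_verts_conv)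
  moreover have "H \<restriction> H.scc_of u \<noteq> H \<restriction> H.scc_of v"
    using calculation(1,2) by (metis induce_subgraph_verts)
  ultimately show ?thesis
    unfolding separating_set_def H_def[symmetric] using assms(5) by blast
qed

text \<open>Comaximality writes 1 as the remainder of \<open>a * x + b * y\<close> modulo
  \<open>m\<close>. A common divisor \<open>d\<close> of \<open>x\<close> and \<open>y\<close>
  divides that sum, and \<open>d dvd m\<close> lets the divisibility pass to the remainder.\<close>

lemma (in residues) comaximal_imp_coprime:
  assumes "x \<in> carrier R" "y \<in> carrier R"
    and sum: "Idl {x} <+> Idl {y} = carrier R"
    and "d dvd x" "d dvd y" "d dvd m"
  shows "d dvd 1"
proof -
  have "\<one> \<in> Idl {x} <+> Idl {y}" using sum by simp
  \<comment> \<open>In a commutative ring the ideal generated by \<open>x\<close> is the set of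
    multiples of \<open>x\<close>, so membership in the sum becomes a Bezout identity.\<close>
  then obtain a b where "\<one> = a \<otimes> x \<oplus> b \<otimes> y"
    using assms(1,2) by (auto simp: set_add_def' cgenideal_eq_genideal[symmetric] cgenideal_def)
  then have "1 = (a * x + b * y) mod m"
    by (simp add: res_add_eq res_mult_eq res_one_eq mod_simps)
  then show ?thesis using assms(4-6) by (metis dvd_add dvd_mod dvd_mult)
qed

lemma wf_digraph_comaximal_G2: "wf_digraph (comaximal_G2 n)"
  unfolding comaximal_G2_def comaximal_graph_def
  by (intro wf_digraph.wellformed_induce_subgraph) (auto simp: wf_digraph_def)

lemma verts_comaximal_G2:
  "verts (comaximal_G2 n) = {y. 0 < y \<and> y < int n \<and> \<not> coprime y (int n)}"
  by (auto simp: comaximal_G2_def nonunits_mod_def residue_ring_def coprime_iff_gcd_eq_1)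

text \<open>As \<open>x dvd int n\<close>, every common divisor of \<open>x\<close> and
  \<open>y\<close> also divides the modulus, so comaximality modulo \<open>n\<close> yields
  coprimality in the integers.\<close>

lemma comaximal_G2_adj_imp_coprime:
  assumes "n > 1" "x \<rightarrow>\<^bsub>comaximal_G2 n\<^esub> y" "x dvd int n"
  shows "coprime x y"
proof (rule coprimeI)
  fix d assume "d dvd x" "d dvd y"
  interpret residues "int n" "residue_ring (int n)"
    using \<open>n > 1\<close> by unfold_locales auto
  show "is_unit d"
    using assms \<open>d dvd x\<close> \<open>d dvd y\<close>
    by (intro comaximal_imp_coprime[of x y])
       (auto simp: comaximal_G2_def comaximal_graph_def arcs_ends_conv)
qed

lemma card_coprime_nonunits_le_totient:
  fixes M q :: nat
  assumes "prime q"
  shows "card {y \<in> verts (comaximal_G2 (M * q)). coprime (int M) y} \<le> totient M"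
proof -
  let ?S = "{y \<in> verts (comaximal_G2 (M * q)). coprime (int M) y}"
  have "?S \<subseteq> (\<lambda>z. int (q * z)) ` totatives M"
  proof
    fix y assume y: "y \<in> ?S"
    then have bnd: "0 < y" "y < int M * int q" and cop: "coprime y (int M)"
      and "\<not> coprime y (int M * int q)"
      by (auto simp: verts_comaximal_G2 coprime_commute)
    \<comment> \<open>Coprimality to a product means coprimality to both factors, and
      \<open>y\<close> is coprime to \<open>M\<close>; the failure lies with
      \<open>q\<close>.\<close>
    then have "\<not> coprime y (int q)" by simp
    then have "int q dvd y"
      using \<open>prime q\<close> by (meson coprime_commute prime_imp_coprime prime_nat_int_transfer)
    then obtain k where k: "y = int q * k" ..
    have "k > 0" using bnd k by (simp add: zero_less_mult_iff)
    then obtain z where z: "k = int z" "z > 0"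
      by (metis of_nat_0_less_iff pos_int_cases)
    have "z < M" using bnd k z \<open>prime q\<close> by (simp add: mult.commute flip: of_nat_mult)
    moreover have "coprime z M" using cop k z by simp
    ultimately show "y \<in> (\<lambda>z. int (q * z)) ` totatives M"
      using k z by (auto simp: totatives_def)
  qed
  then have "card ?S \<le> card (totatives M)"
    by (intro surj_card_le) auto
  then show ?thesis by (simp add: totient_def)
qed

lemma vertex_connectivity_comaximal_G2_le:
  fixes M q :: nat
  assumes "M > 1" "prime q" "q > 2"
  shows "vertex_connectivity (comaximal_G2 (M * q)) \<le> enat (totient M)"
proof -
  let ?G = "comaximal_G2 (M * q)"
  let ?S = "{y \<in> verts ?G. coprime (int M) y}"
  have "2 * M < M * q" using assms by (simp add: mult.commute)
  then have bnd: "2 * int M < int M * int q"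
    by (metis of_nat_less_iff of_nat_mult of_nat_numeral)
  have "finite ?S"
    by (rule finite_subset[of _ "{0..int (M * q)}"]) (auto simp: verts_comaximal_G2)
  have "M * q > 1" using assms \<open>2 * M < M * q\<close> by linarith
  have "separating_set ?G ?S"
  proof (rule separating_set_neighbours[OF wf_digraph_comaximal_G2])
    \<comment> \<open>Both are multiples of \<open>M > 1\<close>, hence coprime neither to
      \<open>M * q\<close> nor to \<open>M\<close>: they are vertices outside
      \<open>?S\<close>.\<close>
    show "int M \<in> verts ?G - ?S" "2 * int M \<in> verts ?G - ?S"
      using assms bnd by (auto simp: verts_comaximal_G2)
    show "int M \<noteq> 2 * int M" using assms by simp
    show "y \<in> ?S" if "int M \<rightarrow>\<^bsub>?G\<^esub> y" for y
      using that comaximal_G2_adj_imp_coprime[OF \<open>M * q > 1\<close> that]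
        wf_digraph.adj_in_verts[OF wf_digraph_comaximal_G2 that] by simp
  qed auto
  then have "vertex_connectivity ?G \<le> enat (card ?S)"
    unfolding vertex_connectivity_def using \<open>finite ?S\<close> by (intro INF_lower) simp
  also have "\<dots> \<le> enat (totient M)"
    using card_coprime_nonunits_le_totient[OF \<open>prime q\<close>] by simp
  finally show ?thesis .
qed

theorem theorem5p6:
  fixes p :: "nat \<Rightarrow> nat" and m n :: nat
  assumes "m \<ge> 2"
    and "\<And>i. i \<in> {1..m} \<Longrightarrow> prime (p i)"
    and "strict_mono_on {1..m} p"
    and "n = (\<Prod>i=1..m. p i)"
  shows "vertex_connectivity (comaximal_G2 n) \<le> enat (totient (\<Prod>i=1..m - 1. p i))"
proof -
  let ?M = "\<Prod>i=1..m - 1. p i"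
  have "n = ?M * p m"
    using assms(1,4) prod.nat_ivl_Suc'[of 1 "m - 1" p] by (simp add: mult.commute)
  \<comment> \<open>With \<open>p 1 \<ge> 2\<close> this gives \<open>p m > 2\<close>.\<close>
  moreover have "p 1 < p m" using assms(1,3) by (auto simp: strict_mono_on_def)
  moreover have "p 1 \<ge> 2" using assms(1,2) by (simp add: prime_ge_2_nat)
  moreover have "prime (p m)" using assms(1,2) by simp
  \<comment> \<open>Since \<open>m \<ge> 2\<close>, the index 1 occurs in the product; together with
    \<open>?M > 0\<close> this gives \<open>?M \<ge> p 1 > 1\<close>.\<close>
  moreover have "p 1 dvd ?M" using assms(1) by (intro dvd_prodI) auto
  moreover have "?M > 0" using assms(1,2) by (intro prod_pos) (auto intro: prime_gt_0_nat)
  ultimately show ?thesis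
    using vertex_connectivity_comaximal_G2_le[of ?M "p m"] dvd_imp_le[of "p 1" ?M] by simp
qed

end
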